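(* Let $R$ be an integral domain. Then $GCl_{int}(R)$ is connected if and only if $R$ is a PID. In this case, $\operatorname{diam}(GCl_{int}(R))\leq 2$, and $\operatorname{diam}(GCl_{int}(R))=1$ if and only if $R$ is local.
   Context: $GCl_{int}(R)$ is the simple undirected graph whose vertices are the nonzero ideals of $R$ (including $R$ itself), with an edge between two distinct nonzero ideals if and only if, for one of the two orderings $(I,J)$ of the pair, there is a nonzero $a\in R$ such that $I=Ja$. The diameter $\operatorname{diam}$ of a graph is the supremum of the distances between pairs of vertices.
   Formalization: The equivalence "diam = 1 iff R is local" is stated only for R not a field: a field is a local PID whose graph has the single vertex R and diameter 0, so the clause fails there. *)

theory Defs
  imports
    "HOL-Algebra.Ring_Divisibility"
    "Graph_Theory.Digraph_Component"
    "Graph_Theory.Shortest_Path"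
begin

text \<open>
  Undirected graphs are represented, as usual in \<open>Graph_Theory\<close>, by symmetric digraphs whose
  arcs are ordered pairs of vertices.
\<close>

definition nonzero_ideals :: "('a, 'b) ring_scheme \<Rightarrow> 'a set set" where
  "nonzero_ideals R = {I. ideal I R \<and> I \<noteq> {\<zero>\<^bsub>R\<^esub>}}"

definition ideal_mult_elem :: "('a, 'b) ring_scheme \<Rightarrow> 'a set \<Rightarrow> 'a \<Rightarrow> 'a set" where
  "ideal_mult_elem R J a = {x \<otimes>\<^bsub>R\<^esub> a | x. x \<in> J}"

definition GCl_int :: "('a, 'b) ring_scheme \<Rightarrow> 'a set pair_pre_digraph" where
  "GCl_int R =
    \<lparr> pverts = nonzero_ideals R,
      parcs = {(I, J). I \<in> nonzero_ideals R \<and> J \<in> nonzero_ideals R \<and> I \<noteq> J \<and>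
        (\<exists>a \<in> carrier R - {\<zero>\<^bsub>R\<^esub>}. I = ideal_mult_elem R J a \<or> J = ideal_mult_elem R I a)} \<rparr>"

lemma pair_wf_digraph_GCl_int: "pair_wf_digraph (GCl_int R)"
  by unfold_locales (auto simp: GCl_int_def)

lemma loopfree_digraph_GCl_int: "loopfree_digraph (with_proj (GCl_int R))"
  by unfold_locales (auto simp: GCl_int_def)

lemma symmetric_GCl_int: "symmetric (with_proj (GCl_int R))"
  by (auto simp: symmetric_def arcs_ends_conv sym_def GCl_int_def)

text \<open>
  With every arc of cost 1, the cost of a walk is its length, so \<open>\<mu>\<close> is the graph distance;
  it is \<open>\<infinity>\<close> between vertices in different components.
\<close>

definition graph_dist :: "('v, 'e) pre_digraph \<Rightarrow> 'v \<Rightarrow> 'v \<Rightarrow> ereal" where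
  "graph_dist G u v = wf_digraph.\<mu> G (\<lambda>_. 1) u v"

definition graph_diam :: "('v, 'e) pre_digraph \<Rightarrow> ereal" where
  "graph_diam G = (SUP (u, v) \<in> verts G \<times> verts G. graph_dist G u v)"

definition local_ring :: "('a, 'b) ring_scheme \<Rightarrow> bool" where
  "local_ring R \<longleftrightarrow> cring R \<and> (\<exists>!M. maximalideal M R)"

end

theory Submission
  imports Defs
begin

text \<open>
  The vertex \<open>R\<close> organises the whole graph. Its neighbours are the nonzero principal ideals
  \<open>Ra\<close> other than \<open>R\<close> itself, so over a principal ideal domain every vertex is within distance 1 of \<open>R\<close>, whence any
  two vertices are within distance 2. Conversely, multiplication by a nonzero \<open>a\<close> is injective
  on a domain, so \<open>J\<close> and \<open>Ja\<close> are isomorphic as modules and one is principal exactly when the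
  other is (lemma \<open>principal_ideal_mult_elem_iff\<close>). Being principal is therefore constant on
  connected components; since \<open>R\<close> is principal, connectedness makes all ideals principal.

  For principal ideals an arc between \<open>Rx\<close> and \<open>Ry\<close> means that one of \<open>x\<close>, \<open>y\<close> divides the
  other. Outside of the case of a field there are at least two vertices, so diameter 1 says that
  any two distinct vertices are adjacent, that is, that divisibility is total. In a local
  principal ideal domain this holds: after dividing \<open>x\<close> and \<open>y\<close> by their greatest common divisor
  they generate \<open>R\<close>, so they cannot both lie in the maximal ideal, and one of them has become a
  unit (lemma \<open>local_divides_total\<close>). Conversely, adjacent ideals are nested, and two nested
  maximal ideals are equal.
\<close>

section \<open>Distances and diameter in graphs with unit costs\<close>

context wf_digraph
begin

lemma graph_dist_le_length:
  assumes "awalk u p v"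
  shows "graph_dist G u v \<le> ereal (length p)"
proof -
  have "awalk_cost (\<lambda>_. 1) p = length p"
    by (simp add: awalk_cost_def sum_list_triv)
  then show ?thesis
    using min_cost_le_walk_cost[OF assms, of "\<lambda>_. 1"] by (simp add: graph_dist_def)
qed

lemma graph_dist_ge:
  assumes "\<And>p. awalk u p v \<Longrightarrow> n \<le> length p"
  shows "ereal n \<le> graph_dist G u v"
  unfolding graph_dist_def \<mu>_def
  by (rule INF_greatest) (use assms in \<open>auto simp: awalk_cost_def sum_list_triv\<close>)

lemma dominates_awalk:
  assumes "u \<rightarrow> v"
  obtains e where "awalk u [e] v"
proof -
  obtain e where "e \<in> arcs G" "tail G e = u" "head G e = v"
    using assms by (auto simp: arcs_ends_conv)
  then have "awalk u [e] v"
    by (auto simp: awalk_simps)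
  then show ?thesis
    using that by blast
qed

lemma graph_dist_dominates_le:
  assumes "u \<rightarrow> v"
  shows "graph_dist G u v \<le> 1"
proof -
  obtain e where "awalk u [e] v"
    using dominates_awalk[OF assms] .
  then show ?thesis
    using graph_dist_le_length[of u "[e]" v] by (simp add: one_ereal_def)
qed

lemma graph_dist_two_steps_le:
  assumes "u \<rightarrow> w" "w \<rightarrow> v"
  shows "graph_dist G u v \<le> 2"
proof -
  obtain e f where "awalk u [e] w" "awalk w [f] v"
    using dominates_awalk assms by metis
  then have "awalk u [e, f] v"
    by (auto simp: awalk_simps)
  then show ?thesis
    using graph_dist_le_length[of u "[e, f]" v] by simp
qed

lemma graph_dist_self_le:
  assumes "u \<in> verts G"
  shows "graph_dist G u u \<le> 0"
  using graph_dist_le_length[of u "[]" u] assms by (simp add: awalk_simps zero_ereal_def)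

lemma graph_dist_ge_1:
  assumes "u \<noteq> v"
  shows "1 \<le> graph_dist G u v"
proof -
  have "1 \<le> length p" if "awalk u p v" for p
    using that assms by (cases p) (auto simp: awalk_simps)
  then show ?thesis
    using graph_dist_ge[of u v 1] by (simp add: one_ereal_def)
qed

lemma graph_dist_ge_2:
  assumes "u \<noteq> v" "\<not> u \<rightarrow> v"
  shows "2 \<le> graph_dist G u v"
proof -
  have "2 \<le> length p" if p: "awalk u p v" for p
  proof (cases p)
    case Nil
    then show ?thesis using p assms by (auto simp: awalk_simps)
  next
    case (Cons e q)
    show ?thesis
    proof (cases q)
      case Nil
      with Cons p have "u \<rightarrow> v"
        by (auto simp: awalk_simps arcs_ends_conv)
      with assms show ?thesis by blast
    qed (simp add: Cons)
  qed
  then show ?thesis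
    using graph_dist_ge[of u v 2] by simp
qed

lemma graph_diam_le_iff:
  "graph_diam G \<le> c \<longleftrightarrow> (\<forall>u \<in> verts G. \<forall>v \<in> verts G. graph_dist G u v \<le> c)"
  unfolding graph_diam_def by (auto simp: SUP_le_iff)

text \<open>
  With a single vertex the diameter is 0 although all distinct vertices are vacuously adjacent,
  hence the requirement of two vertices.
\<close>

lemma graph_diam_eq_1_iff:
  assumes two: "u\<^sub>0 \<in> verts G" "v\<^sub>0 \<in> verts G" "u\<^sub>0 \<noteq> v\<^sub>0"
  shows "graph_diam G = 1 \<longleftrightarrow> (\<forall>u \<in> verts G. \<forall>v \<in> verts G. u \<noteq> v \<longrightarrow> u \<rightarrow> v)"
proof
  assume "graph_diam G = 1"
  then have le: "graph_dist G u v \<le> 1" if "u \<in> verts G" "v \<in> verts G" for u v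
    using that graph_diam_le_iff[of 1] by simp
  have "\<not> (2::ereal) \<le> 1" by simp
  then show "\<forall>u \<in> verts G. \<forall>v \<in> verts G. u \<noteq> v \<longrightarrow> u \<rightarrow> v"
    using le graph_dist_ge_2 order_trans by blast
next
  assume adj: "\<forall>u \<in> verts G. \<forall>v \<in> verts G. u \<noteq> v \<longrightarrow> u \<rightarrow> v"
  have "graph_dist G u v \<le> 1" if "u \<in> verts G" "v \<in> verts G" for u v
  proof (cases "u = v")
    case True
    then show ?thesis
      using graph_dist_self_le[OF that(1)] order_trans[of _ 0 "1::ereal"] by simp
  next
    case False
    then show ?thesis
      using adj that graph_dist_dominates_le by blast
  qed
  then have "graph_diam G \<le> 1"
    by (simp add: graph_diam_le_iff)
  moreover have "1 \<le> graph_diam G"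
    using graph_dist_ge_1[OF two(3)] graph_diam_le_iff[of "graph_diam G"] two
    by (metis order_refl order_trans)
  ultimately show "graph_diam G = 1"
    by (rule antisym)
qed

end

section \<open>Multiplying an ideal by an element\<close>

context domain
begin

lemma ideal_mult_elem_carrier: "ideal_mult_elem R (carrier R) a = PIdl a"
  by (simp add: ideal_mult_elem_def cgenideal_def)

lemma ideal_mult_elem_cgenideal:
  assumes "x \<in> carrier R" "a \<in> carrier R"
  shows "ideal_mult_elem R (PIdl x) a = PIdl (x \<otimes> a)"
  using assms by (auto simp: ideal_mult_elem_def cgenideal_def m_assoc) (metis m_assoc)

lemma ideal_mult_elem_subset:
  assumes "ideal J R" "a \<in> carrier R"
  shows "ideal_mult_elem R J a \<subseteq> J"
  using ideal.I_r_closed[OF assms(1) _ assms(2)] by (auto simp: ideal_mult_elem_def)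

text \<open>
  A generator of \<open>Ja\<close> has the form \<open>ja\<close> with \<open>j\<close> in \<open>J\<close>, and cancelling \<open>a\<close> shows that \<open>j\<close>
  generates \<open>J\<close>.
\<close>

lemma principal_ideal_mult_elem_iff:
  assumes J: "ideal J R" and a: "a \<in> carrier R - {\<zero>}"
  shows "(\<exists>c \<in> carrier R. ideal_mult_elem R J a = PIdl c) \<longleftrightarrow> (\<exists>c \<in> carrier R. J = PIdl c)"
proof
  assume "\<exists>c \<in> carrier R. ideal_mult_elem R J a = PIdl c"
  then obtain c where c: "c \<in> carrier R" and eq: "ideal_mult_elem R J a = PIdl c"
    by blast
  from cgenideal_self[OF c] obtain j where j: "j \<in> J" and c_eq: "c = j \<otimes> a"
    unfolding eq[symmetric] ideal_mult_elem_def by blast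
  have J_carr: "x \<in> carrier R" if "x \<in> J" for x
    using ideal.Icarr[OF J that] .
  have "x \<in> PIdl j" if x: "x \<in> J" for x
  proof -
    have "x \<otimes> a \<in> PIdl c"
      unfolding eq[symmetric] ideal_mult_elem_def using x by blast
    then obtain r where r: "r \<in> carrier R" and "x \<otimes> a = r \<otimes> (j \<otimes> a)"
      unfolding cgenideal_def c_eq by blast
    then have "x \<otimes> a = (r \<otimes> j) \<otimes> a"
      using a J_carr[OF j] by (simp add: m_assoc)
    then have "x = r \<otimes> j"
      using a r J_carr[OF j] J_carr[OF x] m_rcancel[of a x "r \<otimes> j"] by simp
    then show ?thesis
      using r unfolding cgenideal_def by blast
  qed
  then have "J = PIdl j"
    using cgenideal_minimal[OF J j] by blast
  then show "\<exists>c \<in> carrier R. J = PIdl c"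
    using J_carr[OF j] by blast
next
  assume "\<exists>c \<in> carrier R. J = PIdl c"
  then show "\<exists>c \<in> carrier R. ideal_mult_elem R J a = PIdl c"
    using a ideal_mult_elem_cgenideal by (metis DiffD1 m_closed)
qed

section \<open>Connectedness\<close>

lemma pverts_GCl_int [simp]: "pverts (GCl_int R) = nonzero_ideals R"
  by (simp add: GCl_int_def)

lemma carrier_in_nonzero_ideals: "carrier R \<in> nonzero_ideals R"
  using oneideal carrier_one_not_zero by (simp add: nonzero_ideals_def)

lemma cgenideal_in_nonzero_ideals:
  assumes "a \<in> carrier R - {\<zero>}"
  shows "PIdl a \<in> nonzero_ideals R"
  using assms cgenideal_ideal[of a] cgenideal_self[of a] by (auto simp: nonzero_ideals_def)

lemma GCl_int_dominatesI:
  assumes "I \<in> nonzero_ideals R" "J \<in> nonzero_ideals R" "I \<noteq> J"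
    and "a \<in> carrier R - {\<zero>}" "J = ideal_mult_elem R I a"
  shows "I \<rightarrow>\<^bsub>with_proj (GCl_int R)\<^esub> J" "J \<rightarrow>\<^bsub>with_proj (GCl_int R)\<^esub> I"
  using assms by (auto simp: GCl_int_def)

lemma GCl_int_dominatesE:
  assumes "I \<rightarrow>\<^bsub>with_proj (GCl_int R)\<^esub> J"
  obtains a where "ideal I R" "ideal J R" "a \<in> carrier R - {\<zero>}"
    "I = ideal_mult_elem R J a \<or> J = ideal_mult_elem R I a"
  using assms by (auto simp: GCl_int_def nonzero_ideals_def)

lemma principal_ideal_reachable:
  assumes "carrier R \<rightarrow>\<^sup>*\<^bsub>with_proj (GCl_int R)\<^esub> I"
  shows "\<exists>c \<in> carrier R. I = PIdl c"
proof -
  interpret G: pair_wf_digraph "GCl_int R"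
    by (rule pair_wf_digraph_GCl_int)
  from assms show ?thesis
  proof (induction rule: G.reachable_induct)
    case base
    then show ?case
      using ideal_eq_carrier_iff[OF one_closed] by blast
  next
    case (step I J)
    then obtain a where "ideal I R" "ideal J R" "a \<in> carrier R - {\<zero>}"
      "I = ideal_mult_elem R J a \<or> J = ideal_mult_elem R I a"
      using GCl_int_dominatesE[of I J] by auto
    then show ?case
      using step.IH principal_ideal_mult_elem_iff by metis
  qed
qed

lemma connected_imp_principal_domain:
  assumes "Digraph_Component.connected (with_proj (GCl_int R))"
  shows "principal_domain R"
proof -
  interpret G: pair_wf_digraph "GCl_int R"
    by (rule pair_wf_digraph_GCl_int)
  have sc: "strongly_connected (with_proj (GCl_int R))"
    using G.symmetric_connected_imp_strongly_connected[OF symmetric_GCl_int assms] .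
  show ?thesis
  proof unfold_locales
    fix I assume I: "ideal I R"
    show "\<exists>a \<in> carrier R. I = PIdl a"
    proof (cases "I = {\<zero>}")
      case True
      \<comment> \<open>The zero ideal is not a vertex, so connectedness says nothing about it.\<close>
      then show ?thesis
        using genideal_zero cgenideal_eq_genideal[OF zero_closed] by blast
    next
      case False
      then have "I \<in> nonzero_ideals R"
        using I by (simp add: nonzero_ideals_def)
      then have "carrier R \<rightarrow>\<^sup>*\<^bsub>with_proj (GCl_int R)\<^esub> I"
        using sc carrier_in_nonzero_ideals
        by (simp add: strongly_connected_def)
      then show ?thesis
        by (rule principal_ideal_reachable)
    qed
  qed
qed

end

context principal_domain
begin

lemma nonzero_ideals_eq: "nonzero_ideals R = (\<lambda>a. PIdl a) ` (carrier R - {\<zero>})"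
proof
  show "nonzero_ideals R \<subseteq> (\<lambda>a. PIdl a) ` (carrier R - {\<zero>})"
  proof
    fix I assume "I \<in> nonzero_ideals R"
    then obtain a where a: "a \<in> carrier R" "I = PIdl a" "I \<noteq> {\<zero>}"
      using exists_gen unfolding nonzero_ideals_def by blast
    moreover have "PIdl \<zero> = {\<zero>}"
      using genideal_zero cgenideal_eq_genideal[OF zero_closed] by simp
    ultimately show "I \<in> (\<lambda>a. PIdl a) ` (carrier R - {\<zero>})"
      by blast
  qed
  show "(\<lambda>a. PIdl a) ` (carrier R - {\<zero>}) \<subseteq> nonzero_ideals R"
    using cgenideal_in_nonzero_ideals by blast
qed

lemma dominates_carrier:
  assumes "I \<in> nonzero_ideals R" "I \<noteq> carrier R"
  shows "I \<rightarrow>\<^bsub>with_proj (GCl_int R)\<^esub> carrier R" "carrier R \<rightarrow>\<^bsub>with_proj (GCl_int R)\<^esub> I"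
proof -
  obtain a where a: "a \<in> carrier R - {\<zero>}" "I = PIdl a"
    using assms by (auto simp: nonzero_ideals_eq)
  then have "I = ideal_mult_elem R (carrier R) a"
    by (simp add: ideal_mult_elem_carrier)
  then show "I \<rightarrow>\<^bsub>with_proj (GCl_int R)\<^esub> carrier R" "carrier R \<rightarrow>\<^bsub>with_proj (GCl_int R)\<^esub> I"
    using GCl_int_dominatesI[OF carrier_in_nonzero_ideals assms(1) _ a(1)] assms(2) by blast+
qed

lemma connected_GCl_int: "Digraph_Component.connected (with_proj (GCl_int R))"
proof -
  interpret G: pair_wf_digraph "GCl_int R"
    by (rule pair_wf_digraph_GCl_int)
  have carr: "carrier R \<rightarrow>\<^sup>*\<^bsub>with_proj (GCl_int R)\<^esub> carrier R"
    using carrier_in_nonzero_ideals by simp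
  have to: "I \<rightarrow>\<^sup>*\<^bsub>with_proj (GCl_int R)\<^esub> carrier R" if "I \<in> nonzero_ideals R" for I
    using carr G.reachable_adjI dominates_carrier(1)[OF that] by (cases "I = carrier R") simp_all
  have from_: "carrier R \<rightarrow>\<^sup>*\<^bsub>with_proj (GCl_int R)\<^esub> I" if "I \<in> nonzero_ideals R" for I
    using carr G.reachable_adjI dominates_carrier(2)[OF that] by (cases "I = carrier R") simp_all
  show ?thesis
    unfolding Digraph_Component.connected_def strongly_connected_def
    using carrier_in_nonzero_ideals G.reachable_mk_symmetricI[OF G.reachable_trans[OF to from_]]
    by auto
qed

lemma graph_diam_GCl_int_le: "graph_diam (with_proj (GCl_int R)) \<le> 2"
proof -
  interpret G: pair_wf_digraph "GCl_int R"
    by (rule pair_wf_digraph_GCl_int)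
  have le: "x \<le> 2" if "x \<le> 0 \<or> x \<le> 1" for x :: ereal
    using that order_trans[of x 0 2] order_trans[of x 1 2] by auto
  have "graph_dist (with_proj (GCl_int R)) I J \<le> 2"
    if IJ: "I \<in> nonzero_ideals R" "J \<in> nonzero_ideals R" for I J
  proof (cases "I = J")
    case True
    then show ?thesis
      using IJ le G.graph_dist_self_le[of I] by simp
  next
    case False
    consider "I = carrier R" | "J = carrier R" | "I \<noteq> carrier R" "J \<noteq> carrier R"
      by blast
    then show ?thesis
    proof cases
      case 1
      then show ?thesis
        using dominates_carrier(2)[OF IJ(2)] False 1 le G.graph_dist_dominates_le[of I J] by simp
    next
      case 2
      then show ?thesis
        using dominates_carrier(1)[OF IJ(1)] False 2 le G.graph_dist_dominates_le[of I J] by simp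
    next
      case 3
      then show ?thesis
        using dominates_carrier IJ G.graph_dist_two_steps_le[of I "carrier R" J] by simp
    qed
  qed
  then show ?thesis
    by (simp add: G.graph_diam_le_iff)
qed

section \<open>Local principal ideal domains\<close>

text \<open>
  Zorn's lemma is avoided: an irreducible divisor of \<open>a\<close> generates a maximal ideal containing \<open>a\<close>.
\<close>

lemma nonunit_in_maximalideal:
  assumes "a \<in> carrier R - {\<zero>}" "a \<notin> Units R"
  obtains M where "maximalideal M R" "a \<in> M"
proof -
  obtain p where p: "p \<in> carrier R" "ring_irreducible p" "p divides a"
    using exists_irreducible_divisor[OF assms] .
  have "a \<in> PIdl p"
    using to_contain_is_to_divide[of p a] cgenideal_self[of a] p assms by auto
  then show ?thesis
    using irreducible_imp_maximalideal[OF p(1,2)] that by blast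
qed

text \<open>
  Write \<open>x = du\<close> and \<open>y = dv\<close> with \<open>d\<close> a generator of \<open>(x, y)\<close>. Cancelling \<open>d\<close> from a Bezout
  identity for \<open>d\<close> exhibits 1 as a combination of \<open>u\<close> and \<open>v\<close>, so \<open>u\<close> or \<open>v\<close> lies outside of
  the only maximal ideal and is a unit.
\<close>

lemma local_divides_total:
  assumes loc: "local_ring R" and x: "x \<in> carrier R - {\<zero>}" and y: "y \<in> carrier R - {\<zero>}"
  shows "x divides y \<or> y divides x"
proof -
  have xc: "x \<in> carrier R" and yc: "y \<in> carrier R"
    using x y by auto
  obtain d where d: "d \<in> carrier R" "PIdl x <+>\<^bsub>R\<^esub> PIdl y = PIdl d"
    using exists_gen[OF add_ideals[OF cgenideal_ideal[OF xc] cgenideal_ideal[OF yc]]] by blast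
  have gcd: "d gcdof x y"
    using ideal_sum_iff_gcd[OF xc yc d(1)] d(2) by simp
  then obtain u v where u: "u \<in> carrier R" "x = d \<otimes> u" and v: "v \<in> carrier R" "y = d \<otimes> v"
    unfolding isgcd_def factor_def by blast
  have nz: "d \<noteq> \<zero>" "u \<noteq> \<zero>" "v \<noteq> \<zero>"
    using x y u v d(1) by auto
  have "d \<in> PIdl x <+>\<^bsub>R\<^esub> PIdl y"
    using cgenideal_self[OF d(1)] d(2) by simp
  then obtain r s where rs: "r \<in> carrier R" "s \<in> carrier R" "d = r \<otimes> x \<oplus> s \<otimes> y"
    unfolding set_add_def' cgenideal_def by blast
  have "d \<otimes> (r \<otimes> u \<oplus> s \<otimes> v) = r \<otimes> (d \<otimes> u) \<oplus> s \<otimes> (d \<otimes> v)"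
    using d(1) rs(1,2) u(1) v(1) by (simp add: r_distr m_lcomm)
  also have "\<dots> = d \<otimes> \<one>"
    unfolding u(2)[symmetric] v(2)[symmetric] r_one[OF d(1)] by (rule rs(3)[symmetric])
  finally have one: "r \<otimes> u \<oplus> s \<otimes> v = \<one>"
    using nz(1) d(1) rs(1,2) u(1) v(1) m_lcancel[of d "r \<otimes> u \<oplus> s \<otimes> v" \<one>] by simp
  have "u \<in> Units R \<or> v \<in> Units R"
  proof (rule ccontr)
    assume "\<not> (u \<in> Units R \<or> v \<in> Units R)"
    then obtain M N where M: "maximalideal M R" "u \<in> M" and N: "maximalideal N R" "v \<in> N"
      using nonunit_in_maximalideal nz u(1) v(1) by (metis DiffI singletonD)
    then have "M = N"
      using loc unfolding local_ring_def by blast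
    interpret M: maximalideal M R
      by (rule M(1))
    have "\<one> \<in> M"
      using one M.a_closed[OF M.I_l_closed[OF M(2) rs(1)] M.I_l_closed[OF N(2)[folded \<open>M = N\<close>] rs(2)]]
      by simp
    then show False
      using M.I_notcarr M.one_imp_carrier by blast
  qed
  then have "x \<sim> d \<or> y \<sim> d"
    using u v d(1) associatedI2' by blast
  then show ?thesis
    using gcd xc yc d(1) unfolding isgcd_def associated_def
    by (meson divides_trans)
qed

lemma divides_imp_dominates:
  assumes "x \<in> carrier R - {\<zero>}" "y \<in> carrier R - {\<zero>}" "PIdl x \<noteq> PIdl y" "x divides y"
  shows "(PIdl x) \<rightarrow>\<^bsub>with_proj (GCl_int R)\<^esub> (PIdl y)" "(PIdl y) \<rightarrow>\<^bsub>with_proj (GCl_int R)\<^esub> (PIdl x)"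
proof -
  obtain c where c: "c \<in> carrier R" "y = x \<otimes> c"
    using assms(4) unfolding factor_def by blast
  then have "c \<in> carrier R - {\<zero>}"
    using assms(1,2) by auto
  moreover have "PIdl y = ideal_mult_elem R (PIdl x) c"
    using ideal_mult_elem_cgenideal c assms(1) by simp
  ultimately show "(PIdl x) \<rightarrow>\<^bsub>with_proj (GCl_int R)\<^esub> (PIdl y)"
    "(PIdl y) \<rightarrow>\<^bsub>with_proj (GCl_int R)\<^esub> (PIdl x)"
    using GCl_int_dominatesI[OF cgenideal_in_nonzero_ideals[OF assms(1)]
        cgenideal_in_nonzero_ideals[OF assms(2)] assms(3)] by blast+
qed

lemma not_field_nonunit:
  assumes "\<not> Ring.field R"
  obtains a where "a \<in> carrier R - {\<zero>}" "a \<notin> Units R"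
proof -
  have "\<zero> \<notin> Units R"
    using zero_not_one by (auto simp: Units_def)
  then have "Units R \<subseteq> carrier R - {\<zero>}"
    using Units_closed by auto
  then show ?thesis
    using assms that cring_fieldI by blast
qed

text \<open>
  Outside of the case of a field the zero ideal is not maximal, so every maximal ideal is a
  vertex. An arc forces one of its ends to contain the other, which maximal ideals do not allow.
\<close>

lemma complete_GCl_int_imp_local:
  assumes nf: "\<not> Ring.field R"
    and adj: "\<And>I J. \<lbrakk>I \<in> nonzero_ideals R; J \<in> nonzero_ideals R; I \<noteq> J\<rbrakk>
      \<Longrightarrow> I \<rightarrow>\<^bsub>with_proj (GCl_int R)\<^esub> J"
  shows "local_ring R"
proof -
  obtain a where "a \<in> carrier R - {\<zero>}" "a \<notin> Units R"
    using not_field_nonunit[OF nf] .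
  then obtain M where M: "maximalideal M R"
    using nonunit_in_maximalideal by blast
  have nested: "I = J" if "maximalideal I R" "maximalideal J R" "I \<subseteq> J" for I J
    using maximalideal.I_maximal[OF that(1) maximalideal.axioms(1)[OF that(2)] that(3)]
      maximalideal.I_notcarr[OF that(2)]
      additive_subgroup.a_subset[OF ideal.axioms(1)[OF maximalideal.axioms(1)[OF that(2)]]]
    by blast
  have vertex: "I \<in> nonzero_ideals R" if "maximalideal I R" for I
    using that nf zeromaximalideal_eq_field maximalideal.axioms(1)
    by (auto simp: nonzero_ideals_def)
  have "I = J" if I: "maximalideal I R" and J: "maximalideal J R" for I J
  proof (rule ccontr)
    assume "I \<noteq> J"
    then have "I \<rightarrow>\<^bsub>with_proj (GCl_int R)\<^esub> J"
      using adj vertex I J by blast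
    then have "I \<subseteq> J \<or> J \<subseteq> I"
      by (elim GCl_int_dominatesE) (use ideal_mult_elem_subset in blast)
    then show False
      using nested I J \<open>I \<noteq> J\<close> by blast
  qed
  then show ?thesis
    using M is_cring unfolding local_ring_def by blast
qed

lemma graph_diam_GCl_int_eq_1_iff:
  assumes nf: "\<not> Ring.field R"
  shows "graph_diam (with_proj (GCl_int R)) = 1 \<longleftrightarrow> local_ring R"
proof -
  interpret G: pair_wf_digraph "GCl_int R"
    by (rule pair_wf_digraph_GCl_int)
  obtain a where a: "a \<in> carrier R - {\<zero>}" "a \<notin> Units R"
    using not_field_nonunit[OF nf] .
  have "carrier R \<noteq> PIdl a"
    using a ideal_eq_carrier_iff by blast
  then have "graph_diam (with_proj (GCl_int R)) = 1 \<longleftrightarrow>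
      (\<forall>I \<in> nonzero_ideals R. \<forall>J \<in> nonzero_ideals R. I \<noteq> J \<longrightarrow> I \<rightarrow>\<^bsub>with_proj (GCl_int R)\<^esub> J)"
    using G.graph_diam_eq_1_iff[of "carrier R" "PIdl a"] carrier_in_nonzero_ideals
      cgenideal_in_nonzero_ideals[OF a(1)] by simp
  also have "\<dots> \<longleftrightarrow> local_ring R"
  proof
    assume loc: "local_ring R"
    show "\<forall>I \<in> nonzero_ideals R. \<forall>J \<in> nonzero_ideals R. I \<noteq> J \<longrightarrow>
        I \<rightarrow>\<^bsub>with_proj (GCl_int R)\<^esub> J"
    proof (intro ballI impI)
      fix I J assume "I \<in> nonzero_ideals R" "J \<in> nonzero_ideals R" and ne: "I \<noteq> J"
      then obtain x y where xy: "x \<in> carrier R - {\<zero>}" "y \<in> carrier R - {\<zero>}"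
        and IJ: "I = PIdl x" "J = PIdl y"
        unfolding nonzero_ideals_eq by blast
      show "I \<rightarrow>\<^bsub>with_proj (GCl_int R)\<^esub> J"
        using local_divides_total[OF loc xy] divides_imp_dominates xy ne
        unfolding IJ by metis
    qed
  qed (use complete_GCl_int_imp_local[OF nf] in blast)
  finally show ?thesis .
qed

end

section \<open>Connectedness and diameter of the graph of nonzero ideals\<close>

theorem theorem4p3:
  fixes R :: "('a, 'b) ring_scheme"
  assumes "domain R"
  shows "(Digraph_Component.connected (with_proj (GCl_int R)) \<longleftrightarrow> principal_domain R) \<and>
    (principal_domain R \<longrightarrow>
      graph_diam (with_proj (GCl_int R)) \<le> 2 \<and>
      (\<not> Ring.field R \<longrightarrow>
        (graph_diam (with_proj (GCl_int R)) = 1 \<longleftrightarrow> local_ring R)))"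
  using domain.connected_imp_principal_domain[OF assms]
    principal_domain.connected_GCl_int[of R]
    principal_domain.graph_diam_GCl_int_le[of R]
    principal_domain.graph_diam_GCl_int_eq_1_iff[of R]
  by blast

end
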